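(* For any time $t$, the set of centers returned by $\textsc{Query}(t)$ of Algorithm A (described in the context) is a $(2+\varepsilon)$-approximation for the $k$-center problem on the active set $X_t$, i.e., it has at most $k$ points of $X_t$ and $r_{C}(X_t)\le(2+\varepsilon)\,r_k^*(X_t)$.
   Context: Let $(\mathcal U,d)$ be a metric space, $X\subseteq\mathcal U$ finite, $k\ge1$ an integer. Each $p\in X$ has an arrival time $t_{\rm arr}(p)\in\mathbb N$ and a deletion time $t_{\rm del}(p)\in\mathbb N$ with $t_{\rm arr}(p)<t_{\rm del}(p)$; arrival times are pairwise distinct. The active set at time $t$ is $X_t=\{p\in X: t_{\rm arr}(p)\le t<t_{\rm del}(p)\}$. For $C\subseteq X$, $d(p,C)=\min_{q\in C}d(p,q)$, $r_C(S)=\max_{p\in S}d(p,C)$, and $r_k^*(S)=\min_{C\subseteq S,|C|\le k}r_C(S)$ ($k$-center problem). Let $d_{\min},d_{\max}$ be the minimum and maximum distance between two distinct points of $X$ (assumed known), $\Delta=d_{\max}/d_{\min}$. Let $\varepsilon>0$, $\beta=\varepsilon/2$, and $\Gamma=\{(1+\beta)^i:\lfloor\log_{1+\beta}d_{\min}\rfloor\le i\le\lceil\log_{1+\beta}d_{\max}\rceil\}$. Algorithm A: for each $\gamma\in\Gamma$ it maintains an ordered list of centers $C^\gamma=(c_1,\dots,c_\ell)$, $\ell\le k$, disjoint clusters $D_1,\dots,D_\ell$ ($c_i\in D_i$), and an unclustered set $U^\gamma$; all current points are also in a priority queue $Q$ keyed by deletion time (ties by arrival time). For a cluster $D_i$,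 let $P_i=\{x\in D_i: t_{\rm del}(c_i)<t_{\rm del}(x)\}$ and $V_i=D_i\setminus P_i$. $\textsc{Update}(p,t)$: while the minimum deletion time in $Q$ is $\le t$, remove that point $q$ from $Q$ and call $\textsc{Delete}(q,\gamma)$ for all $\gamma\in\Gamma$; then, if $p\ne$ null, call $\textsc{Insert}(p,\gamma)$ for all $\gamma$ and insert $p$ into $Q$. It is called at each arrival ($t=t_{\rm arr}(p)$) or with $p=$ null to flush expired points. $\textsc{Insert}(p,\gamma)$: put $p$ into $D_i$ for the smallest $i$ with $d(p,c_i)\le2\gamma$; if none exists, then if $\ell<k$ make $p$ the new center $c_{\ell+1}$ with cluster $D_{\ell+1}=\{p\}$ and increment $\ell$, else put $p$ in $U^\gamma$. Then call $\textsc{Reclustering}(\gamma)$. $\textsc{Delete}(p,\gamma)$: if $p$ is not a center, remove it from $U^\gamma$ or its cluster. Otherwise $p=c_i$: for each $x\in D_i\setminus\{p\}$, insert $x$ into $D_j$ for the smallest $j>i$ with $d(x,c_j)\le2\gamma$; if none, then if $\ell<k$ make $x$ a new center $c_{\ell+1}$ of a new cluster and increment $\ell$, else put $x$ in $U^\gamma$. Remove $c_i$ and $D_i$, decrement $\ell$, and reindex contiguously preserving order. If $U^\gamma\ne\emptyset$: pick $u\in U^\gamma$ with maximum $t_{\rm del}$, remove it from $U^\gamma$, make it new center $c_{\ell+1}$ (increment $\ell$), and move into its cluster every $x\in U^\gamma$ with $d(x,u)\le2\gamma$. Then call $\textsc{Reclustering}(\gamma)$. $\textsc{Reclustering}(\gamma)$: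 let $i$ be the smallest index with $\sum_{j=i}^{\ell}|P_j|>|U^\gamma|+\sum_{j=i}^{\ell}|V_j|$; if none, return. Otherwise let $U'=U^\gamma\cup\bigcup_{j\ge i}D_j$, remove centers $c_j$ and clusters $D_j$ for $j\ge i$; for $j=i,\dots,k$: if $U'=\emptyset$ set $\ell=j-1$ and stop; else pick $u\in U'$ with maximum $t_{\rm del}$, remove it from $U'$, make it center $c_j$, and move from $U'$ into $D_j$ every $x$ with $d(x,u)\le2\gamma$ (if the loop completes, $\ell=k$). Finally set $U^\gamma=U'$. $\textsc{Query}(t)$ (called when the structure contains no expired points, ensured by first calling $\textsc{Update}(\text{null},t)$ if needed): return $C^{\gamma^*}$ where $\gamma^*=\min\{\gamma\in\Gamma:U^\gamma=\emptyset\}$.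
   Formalization: The inequality is proved only if |X_t|>k or all active points are pairwise more than 2·min Γ apart; otherwise it fails (k=2, two points at distance 1, ε=1: r_C=1, r_k^*=0). That C consists of at most k points of X_t holds always. X is assumed to have at least two points. *)

theory Defs
  imports "HOL-Analysis.Analysis"
begin

section \<open>The \<open>k\<close>-center problem on the active set\<close>

definition active :: "'a set \<Rightarrow> ('a \<Rightarrow> nat) \<Rightarrow> ('a \<Rightarrow> nat) \<Rightarrow> nat \<Rightarrow> 'a set" where
  "active X t_arr t_del t = {p \<in> X. t_arr p \<le> t \<and> t < t_del p}"

text \<open>
  Costs take values in \<^typ>\<open>ennreal\<close>, so that the distance to an empty set of centers is
  infinite and the cost of covering the empty set is \<open>0\<close>; for finite nonempty sets the infima
  and suprema below are minima and maxima.
\<close>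

definition dist_to :: "'a::metric_space \<Rightarrow> 'a set \<Rightarrow> ennreal" where
  "dist_to p C = (INF q\<in>C. ennreal (dist p q))"

definition cost :: "'a::metric_space set \<Rightarrow> 'a set \<Rightarrow> ennreal" where
  "cost C S = (SUP p\<in>S. dist_to p C)"

definition opt_cost :: "nat \<Rightarrow> 'a::metric_space set \<Rightarrow> ennreal" where
  "opt_cost k S = (INF C\<in>{C. C \<subseteq> S \<and> finite C \<and> card C \<le> k}. cost C S)"


section \<open>The guesses\<close>

definition pair_dists :: "'a::metric_space set \<Rightarrow> real set" where
  "pair_dists X = {dist x y | x y. x \<in> X \<and> y \<in> X \<and> x \<noteq> y}"

definition d_min :: "'a::metric_space set \<Rightarrow> real" where
  "d_min X = Min (pair_dists X)"

definition d_max :: "'a::metric_space set \<Rightarrow> real" where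
  "d_max X = Max (pair_dists X)"

definition guesses :: "'a::metric_space set \<Rightarrow> real \<Rightarrow> real set" where
  "guesses X \<epsilon> = (let \<beta> = \<epsilon> / 2 in
     {(1 + \<beta>) powi i | i. \<lfloor>log (1 + \<beta>) (d_min X)\<rfloor> \<le> i \<and> i \<le> \<lceil>log (1 + \<beta>) (d_max X)\<rceil>})"


text \<open>
  The smallest guess exceeds \<open>d_min / (1 + \<beta>)\<close>, so that the radius \<open>2\<gamma>\<close> of a cluster can be
  as large as the distance between two points. If \<open>S\<close> has at most \<open>k\<close> points, then
  \<open>opt_cost k S = 0\<close>, and if two of them are within twice the smallest guess, the centers that
  a query returns are more than that apart, hence do not include both, and have positive cost.
  No approximation factor is attained in this degenerate case; for example two points at distance
  \<open>1\<close> with \<open>k = 2\<close> and \<open>\<epsilon> = 1\<close> end up in one cluster. An approximation guarantee therefore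
  has to assume that there are more than \<open>k\<close> active points, or that the active points are more
  than twice the smallest guess apart.
\<close>


section \<open>The data structure for one guess\<close>

text \<open>
  A pair \<open>(L, U)\<close>: the list \<open>L = [(c\<^sub>1, D\<^sub>1), \<dots>, (c\<^sub>\<ell>, D\<^sub>\<ell>)]\<close> of centers with their
  clusters, and the unclustered set \<open>U\<close>. List positions count from \<open>0\<close>.

  The algorithm leaves some choices open: which point to pick among those with maximum deletion
  time, and the order in which the points of a dissolved cluster are reinserted. Its operations
  are therefore relations between the states before and after, and allow every such choice.
\<close>

type_synonym 'a clustering = "('a \<times> 'a set) list \<times> 'a set"

text \<open>Put \<open>x\<close> into the first cluster at a position \<open>\<ge> m\<close> whose center is within \<open>2\<gamma>\<close>; failing
  that, open a new cluster if there are fewer than \<open>k\<close>; failing that, leave \<open>x\<close> unclustered.\<close>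

definition place ::
    "nat \<Rightarrow> real \<Rightarrow> nat \<Rightarrow> 'a::metric_space \<Rightarrow> 'a clustering \<Rightarrow> 'a clustering" where
  "place k \<gamma> m x = (\<lambda>(L, U).
     let J = {j. m \<le> j \<and> j < length L \<and> dist x (fst (L ! j)) \<le> 2 * \<gamma>} in
     if J \<noteq> {} then
       let j = Min J in (L[j := (fst (L ! j), insert x (snd (L ! j)))], U)
     else if length L < k then (L @ [(x, {x})], U)
     else (L, insert x U))"

text \<open>Turn an unclustered point with maximum deletion time into a new center.\<close>

inductive open_center ::
    "('a::metric_space \<Rightarrow> nat) \<Rightarrow> real \<Rightarrow> 'a clustering \<Rightarrow> 'a clustering \<Rightarrow> bool"
  for t_del :: "'a \<Rightarrow> nat" and \<gamma> :: real where
  "\<lbrakk>u \<in> U; \<forall>v\<in>U. t_del v \<le> t_del u; N = {x \<in> U - {u}. dist x u \<le> 2 * \<gamma>}\<rbrakk>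
    \<Longrightarrow> open_center t_del \<gamma> (L, U) (L @ [(u, insert u N)], U - {u} - N)"

inductive rebuild ::
    "('a::metric_space \<Rightarrow> nat) \<Rightarrow> nat \<Rightarrow> real \<Rightarrow> 'a clustering \<Rightarrow> 'a clustering \<Rightarrow> bool"
  for t_del :: "'a \<Rightarrow> nat" and k :: nat and \<gamma> :: real where
  stop: "U = {} \<or> k \<le> length L \<Longrightarrow> rebuild t_del k \<gamma> (L, U) (L, U)"
| step: "\<lbrakk>U \<noteq> {}; length L < k; open_center t_del \<gamma> (L, U) T; rebuild t_del k \<gamma> T T'\<rbrakk>
    \<Longrightarrow> rebuild t_del k \<gamma> (L, U) T'"

definition P_part :: "('a \<Rightarrow> nat) \<Rightarrow> 'a \<times> 'a set \<Rightarrow> 'a set" where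
  "P_part t_del = (\<lambda>(c, D). {x \<in> D. t_del c < t_del x})"

definition V_part :: "('a \<Rightarrow> nat) \<Rightarrow> 'a \<times> 'a set \<Rightarrow> 'a set" where
  "V_part t_del cD = snd cD - P_part t_del cD"

definition unbalanced :: "('a \<Rightarrow> nat) \<Rightarrow> 'a clustering \<Rightarrow> nat \<Rightarrow> bool" where
  "unbalanced t_del = (\<lambda>(L, U) i. i < length L \<and>
     (\<Sum>j=i..<length L. card (P_part t_del (L ! j)))
       > card U + (\<Sum>j=i..<length L. card (V_part t_del (L ! j))))"

inductive reclustering ::
    "('a::metric_space \<Rightarrow> nat) \<Rightarrow> nat \<Rightarrow> real \<Rightarrow> 'a clustering \<Rightarrow> 'a clustering \<Rightarrow> bool"
  for t_del :: "'a \<Rightarrow> nat" and k :: nat and \<gamma> :: real where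
  balanced: "\<forall>i. \<not> unbalanced t_del T i \<Longrightarrow> reclustering t_del k \<gamma> T T"
| recluster: "\<lbrakk>unbalanced t_del (L, U) i; \<forall>j<i. \<not> unbalanced t_del (L, U) j;
     rebuild t_del k \<gamma> (take i L, U \<union> (\<Union>j\<in>{i..<length L}. snd (L ! j))) T'\<rbrakk>
    \<Longrightarrow> reclustering t_del k \<gamma> (L, U) T'"

definition insertion ::
    "('a::metric_space \<Rightarrow> nat) \<Rightarrow> nat \<Rightarrow> 'a \<Rightarrow> real \<Rightarrow> 'a clustering \<Rightarrow> 'a clustering \<Rightarrow> bool"
  where "insertion t_del k p \<gamma> T T' \<longleftrightarrow> reclustering t_del k \<gamma> (place k \<gamma> 0 p T) T'"

text \<open>
  The description of the algorithm can be read as calling the reclustering step after the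
  deletion of any point, or only after the deletion of a center. The first two rules admit both.
  In the third, the dissolved cluster stays in the list, and counts as one of the at most \<open>k\<close>
  clusters, until all its points have been placed.
\<close>

inductive deletion ::
    "('a::metric_space \<Rightarrow> nat) \<Rightarrow> nat \<Rightarrow> 'a \<Rightarrow> real \<Rightarrow> 'a clustering \<Rightarrow> 'a clustering \<Rightarrow> bool"
  for t_del :: "'a \<Rightarrow> nat" and k :: nat and p :: 'a and \<gamma> :: real where
  non_center: "p \<notin> fst ` set L
    \<Longrightarrow> deletion t_del k p \<gamma> (L, U) (map (\<lambda>(c, D). (c, D - {p})) L, U - {p})"
| non_center_recluster: "\<lbrakk>p \<notin> fst ` set L;
     reclustering t_del k \<gamma> (map (\<lambda>(c, D). (c, D - {p})) L, U - {p}) T'\<rbrakk>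
    \<Longrightarrow> deletion t_del k p \<gamma> (L, U) T'"
| center: "\<lbrakk>i < length L; fst (L ! i) = p;
     distinct xs; set xs = snd (L ! i) - {p};
     fold (place k \<gamma> (Suc i)) xs (L, U) = (L1, U1);
     L2 = take i L1 @ drop (Suc i) L1;
     if U1 = {} then T = (L2, U1) else open_center t_del \<gamma> (L2, U1) T;
     reclustering t_del k \<gamma> T T'\<rbrakk>
    \<Longrightarrow> deletion t_del k p \<gamma> (L, U) T'"


section \<open>The algorithm\<close>

text \<open>The queue contents together with one clustering for every guess; the values of the second
  component outside the set \<open>G\<close> of guesses are irrelevant.\<close>

type_synonym 'a state = "'a set \<times> (real \<Rightarrow> 'a clustering)"

inductive flush ::
    "('a::metric_space \<Rightarrow> nat) \<Rightarrow> ('a \<Rightarrow> nat) \<Rightarrow> nat \<Rightarrow> real set \<Rightarrow> nat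
      \<Rightarrow> 'a state \<Rightarrow> 'a state \<Rightarrow> bool"
  for t_arr t_del :: "'a \<Rightarrow> nat" and k :: nat and G :: "real set" and t :: nat where
  no_expired: "\<forall>q\<in>Q. t < t_del q \<Longrightarrow> flush t_arr t_del k G t (Q, S) (Q, S)"
| remove_min: "\<lbrakk>q \<in> Q; t_del q \<le> t;
     \<forall>q'\<in>Q. t_del q < t_del q' \<or> (t_del q = t_del q' \<and> t_arr q \<le> t_arr q');
     \<forall>\<gamma>\<in>G. deletion t_del k q \<gamma> (S \<gamma>) (S1 \<gamma>);
     flush t_arr t_del k G t (Q - {q}, S1) \<sigma>'\<rbrakk>
    \<Longrightarrow> flush t_arr t_del k G t (Q, S) \<sigma>'"

inductive update ::
    "('a::metric_space \<Rightarrow> nat) \<Rightarrow> ('a \<Rightarrow> nat) \<Rightarrow> nat \<Rightarrow> real set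
      \<Rightarrow> 'a option \<Rightarrow> nat \<Rightarrow> 'a state \<Rightarrow> 'a state \<Rightarrow> bool"
  for t_arr t_del :: "'a \<Rightarrow> nat" and k :: nat and G :: "real set" where
  null: "flush t_arr t_del k G t \<sigma> \<sigma>' \<Longrightarrow> update t_arr t_del k G None t \<sigma> \<sigma>'"
| arrival: "\<lbrakk>flush t_arr t_del k G t \<sigma> (Q, S); \<forall>\<gamma>\<in>G. insertion t_del k p \<gamma> (S \<gamma>) (S' \<gamma>)\<rbrakk>
    \<Longrightarrow> update t_arr t_del k G (Some p) t \<sigma> (insert p Q, S')"

inductive run ::
    "('a::metric_space \<Rightarrow> nat) \<Rightarrow> ('a \<Rightarrow> nat) \<Rightarrow> nat \<Rightarrow> real set
      \<Rightarrow> ('a option \<times> nat) list \<Rightarrow> 'a state \<Rightarrow> bool"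
  for t_arr t_del :: "'a \<Rightarrow> nat" and k :: nat and G :: "real set" where
  init: "run t_arr t_del k G [] ({}, \<lambda>_. ([], {}))"
| call: "\<lbrakk>run t_arr t_del k G calls \<sigma>; update t_arr t_del k G p t \<sigma> \<sigma>'\<rbrakk>
    \<Longrightarrow> run t_arr t_del k G (calls @ [(p, t)]) \<sigma>'"

text \<open>
  A possible history of update calls up to time \<open>t\<close>: calls in chronological order, exactly one
  call for each point that has arrived, at its arrival time, and any number of flushing calls
  at arbitrary times.
\<close>

definition history ::
    "'a set \<Rightarrow> ('a \<Rightarrow> nat) \<Rightarrow> nat \<Rightarrow> ('a option \<times> nat) list \<Rightarrow> bool" where
  "history X t_arr t calls \<longleftrightarrow>
     sorted (map snd calls) \<and> (\<forall>s\<in>set (map snd calls). s \<le> t) \<and>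
     (\<forall>p s. (Some p, s) \<in> set calls \<longrightarrow> s = t_arr p) \<and>
     distinct (List.map_filter fst calls) \<and>
     set (List.map_filter fst calls) = {p \<in> X. t_arr p \<le> t}"

text \<open>The states in which a query at time \<open>t\<close> may be answered: no expired point is stored.\<close>

definition query_state ::
    "'a::metric_space set \<Rightarrow> ('a \<Rightarrow> nat) \<Rightarrow> ('a \<Rightarrow> nat) \<Rightarrow> nat \<Rightarrow> real \<Rightarrow> nat
      \<Rightarrow> 'a state \<Rightarrow> bool" where
  "query_state X t_arr t_del k \<epsilon> t \<sigma> \<longleftrightarrow>
     (\<exists>calls. history X t_arr t calls \<and> run t_arr t_del k (guesses X \<epsilon>) calls \<sigma>) \<and>
     (\<forall>q\<in>fst \<sigma>. t < t_del q)"

definition query :: "real set \<Rightarrow> 'a state \<Rightarrow> 'a list" where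
  "query G = (\<lambda>(Q, S). map fst (fst (S (Min {\<gamma> \<in> G. snd (S \<gamma>) = {}}))))"

end

theory Submission
  imports Defs
begin

text \<open>
  For every guess \<open>\<gamma>\<close>, each cluster lies within \<open>2\<gamma>\<close> of its center, while its points and the
  unclustered points are farther than \<open>2\<gamma>\<close> from all earlier centers; moreover there are exactly
  \<open>k\<close> centers whenever some point is unclustered. All operations preserve this. A nonempty
  unclustered set thus exhibits \<open>k + 1\<close> points that are pairwise more than \<open>2\<gamma>\<close> apart, so that
  the optimum is at least \<open>\<gamma>\<close>. A query returns centers of cost at most \<open>2\<gamma>\<close> for a \<open>\<gamma>\<close> whose
  predecessor \<open>\<gamma> / (1 + \<epsilon> / 2)\<close> is such a lower bound, unless \<open>\<gamma>\<close> is the smallest guess. In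
  that case \<open>\<gamma> \<le> d_min\<close>, and \<open>d_min\<close> bounds the optimum from below if more than \<open>k\<close> points are
  active, while active points more than \<open>2\<gamma>\<close> apart are all centers themselves.
\<close>

section \<open>Greedy covers\<close>

text \<open>The order condition also makes the clusters disjoint from each other and from \<open>U\<close>.\<close>

definition greedy_cover :: "real \<Rightarrow> 'a::metric_space set \<Rightarrow> 'a clustering \<Rightarrow> bool" where
  "greedy_cover r S = (\<lambda>(L, U).
     S = U \<union> (\<Union>cD\<in>set L. snd cD) \<and>
     (\<forall>cD\<in>set L. fst cD \<in> snd cD \<and> (\<forall>x\<in>snd cD. dist x (fst cD) \<le> r)) \<and>
     sorted_wrt (\<lambda>cD cD'. \<forall>x\<in>snd cD'. r < dist x (fst cD)) L \<and>
     (\<forall>x\<in>U. \<forall>cD\<in>set L. r < dist x (fst cD)))"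

definition valid_clustering ::
    "nat \<Rightarrow> real \<Rightarrow> 'a::metric_space set \<Rightarrow> 'a clustering \<Rightarrow> bool" where
  "valid_clustering k \<gamma> S T \<longleftrightarrow> greedy_cover (2 * \<gamma>) S T \<and> length (fst T) \<le> k \<and>
     (snd T \<noteq> {} \<longrightarrow> length (fst T) = k)"

lemma greedy_cover_insert_cluster:
  assumes "greedy_cover r S (ys @ cD # zs, U)" and "dist x (fst cD) \<le> r"
    and "\<forall>cD\<in>set ys. r < dist x (fst cD)"
  shows "greedy_cover r (insert x S) (ys @ (fst cD, insert x (snd cD)) # zs, U)"
  using assms by (auto simp: greedy_cover_def sorted_wrt_append)

lemma greedy_cover_snoc:
  assumes "greedy_cover r S (L, U)" and "u \<in> N" and "\<forall>x\<in>N. dist x u \<le> r"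
    and "\<forall>x\<in>N. \<forall>cD\<in>set L. r < dist x (fst cD)" and "\<forall>x\<in>U - N. r < dist x u"
  shows "greedy_cover r (S \<union> N) (L @ [(u, N)], U - N)"
  using assms by (auto simp: greedy_cover_def sorted_wrt_append)

lemma greedy_cover_insert_unclustered:
  assumes "greedy_cover r S (L, U)" and "\<forall>cD\<in>set L. r < dist x (fst cD)"
  shows "greedy_cover r (insert x S) (L, insert x U)"
  using assms by (auto simp: greedy_cover_def)

lemma greedy_cover_open_center:
  assumes "open_center t_del \<gamma> (L, U) T" and "greedy_cover (2 * \<gamma>) S (L, U)" and "0 \<le> \<gamma>"
  shows "greedy_cover (2 * \<gamma>) S T" and "length (fst T) = Suc (length L)"
proof -
  from assms(1) obtain u N where u: "u \<in> U" and N: "N = {x \<in> U - {u}. dist x u \<le> 2 * \<gamma>}"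
    and T: "T = (L @ [(u, insert u N)], U - {u} - N)"
    by (auto elim: open_center.cases)
  have far: "\<forall>x\<in>U. \<forall>cD\<in>set L. 2 * \<gamma> < dist x (fst cD)" and sub: "U \<subseteq> S"
    using assms(2) by (auto simp: greedy_cover_def)
  have "greedy_cover (2 * \<gamma>) (S \<union> insert u N) (L @ [(u, insert u N)], U - insert u N)"
    by (rule greedy_cover_snoc[OF assms(2)]) (use u N far assms(3) in auto)
  moreover have "S \<union> insert u N = S" using u N sub by auto
  moreover have "U - insert u N = U - {u} - N" by auto
  ultimately show "greedy_cover (2 * \<gamma>) S T" using T by simp
  show "length (fst T) = Suc (length L)" using T by simp
qed

lemma greedy_cover_dissolve_tail:
  assumes "greedy_cover r S (ys @ zs, U)"
  shows "greedy_cover r S (ys, U \<union> (\<Union>cD\<in>set zs. snd cD))"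
  using assms by (auto simp: greedy_cover_def sorted_wrt_append)

lemma greedy_cover_delete_cluster:
  assumes "greedy_cover r S (ys @ cD # zs, U)"
  shows "greedy_cover r (S - snd cD) (ys @ zs, U)"
proof -
  have "r < dist x (fst cD)" if "x \<in> U \<or> (\<exists>cD'\<in>set zs. x \<in> snd cD')" for x
    using that assms by (auto simp: greedy_cover_def sorted_wrt_append)
  moreover have "dist x (fst cD) \<le> r" if "x \<in> snd cD" for x
    using that assms by (auto simp: greedy_cover_def)
  moreover have "r < dist x (fst cD')" if "x \<in> snd cD" "cD' \<in> set ys" for x cD'
    using that assms by (auto simp: greedy_cover_def sorted_wrt_append)
  moreover have "dist x (fst cD') \<le> r" if "x \<in> snd cD'" "cD' \<in> set ys" for x cD'
    using that assms by (auto simp: greedy_cover_def)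
  ultimately have "snd cD \<inter> (U \<union> (\<Union>cD'\<in>set (ys @ zs). snd cD')) = {}"
    by (fastforce simp: not_le[symmetric])
  then show ?thesis
    using assms by (auto simp: greedy_cover_def sorted_wrt_append)
qed

lemma greedy_cover_delete_non_center:
  assumes "greedy_cover r S (L, U)" and "p \<notin> fst ` set L"
  shows "greedy_cover r (S - {p}) (map (\<lambda>(c, D). (c, D - {p})) L, U - {p})"
proof -
  have "sorted_wrt (\<lambda>cD cD'. \<forall>x\<in>snd cD'. r < dist x (fst cD)) (map (\<lambda>(c, D). (c, D - {p})) L)"
    unfolding sorted_wrt_map
    by (rule sorted_wrt_mono_rel[of L "\<lambda>cD cD'. \<forall>x\<in>snd cD'. r < dist x (fst cD)"])
      (use assms(1) in \<open>auto simp: greedy_cover_def\<close>)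
  then show ?thesis
    using assms by (auto simp: greedy_cover_def case_prod_beta image_iff)
qed


section \<open>The operations preserve validity\<close>

lemma place_eq:
  assumes "J = {j. m \<le> j \<and> j < length L \<and> dist x (fst (L ! j)) \<le> 2 * \<gamma>}"
  shows "place k \<gamma> m x (L, U) =
    (if J \<noteq> {} then (L[Min J := (fst (L ! Min J), insert x (snd (L ! Min J)))], U)
     else if length L < k then (L @ [(x, {x})], U) else (L, insert x U))"
  by (simp only: place_def assms Let_def prod.case)

lemma valid_clustering_place:
  assumes "valid_clustering k \<gamma> S T" and "0 \<le> \<gamma>"
  shows "valid_clustering k \<gamma> (insert x S) (place k \<gamma> 0 x T)"
proof -
  obtain L U where T: "T = (L, U)" by (cases T)
  have gc: "greedy_cover (2 * \<gamma>) S (L, U)" and len: "length L \<le> k" "U \<noteq> {} \<Longrightarrow> length L = k"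
    using assms(1) T by (auto simp: valid_clustering_def)
  define J where "J = {j. 0 \<le> j \<and> j < length L \<and> dist x (fst (L ! j)) \<le> 2 * \<gamma>}"
  show ?thesis
  proof (cases "J = {}")
    case False
    define j where "j = Min J"
    have "finite J" by (simp add: J_def)
    then have "j \<in> J" using False by (simp add: j_def)
    then have j: "j < length L" "dist x (fst (L ! j)) \<le> 2 * \<gamma>" by (auto simp: J_def)
    have before: "2 * \<gamma> < dist x (fst (L ! i))" if "i < j" for i
    proof (rule ccontr)
      assume "\<not> 2 * \<gamma> < dist x (fst (L ! i))"
      then have "i \<in> J" using that j by (auto simp: J_def)
      then have "j \<le> i" using \<open>finite J\<close> by (simp add: j_def)
      with that show False by simp
    qed
    have "greedy_cover (2 * \<gamma>) S (take j L @ L ! j # drop (Suc j) L, U)"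
      using gc id_take_nth_drop[OF j(1)] by simp
    moreover have "\<forall>cD\<in>set (take j L). 2 * \<gamma> < dist x (fst cD)"
      unfolding all_set_conv_all_nth using before by simp
    ultimately have "greedy_cover (2 * \<gamma>) (insert x S)
        (take j L @ (fst (L ! j), insert x (snd (L ! j))) # drop (Suc j) L, U)"
      by (intro greedy_cover_insert_cluster j(2))
    moreover have "place k \<gamma> 0 x T = (L[j := (fst (L ! j), insert x (snd (L ! j)))], U)"
      using False by (simp add: T place_eq[OF J_def] j_def)
    ultimately show ?thesis
      using j len by (simp add: valid_clustering_def upd_conv_take_nth_drop)
  next
    case True
    then have far: "\<forall>cD\<in>set L. 2 * \<gamma> < dist x (fst cD)"
      by (force simp: J_def in_set_conv_nth)
    show ?thesis
    proof (cases "length L < k")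
      case less: True
      then have "U = {}" using len by auto
      moreover have "place k \<gamma> 0 x T = (L @ [(x, {x})], U)"
        using True less by (simp add: T place_eq[OF J_def])
      moreover have "greedy_cover (2 * \<gamma>) (S \<union> {x}) (L @ [(x, {x})], U - {x})"
        by (rule greedy_cover_snoc[OF gc]) (use far assms(2) \<open>U = {}\<close> in auto)
      ultimately show ?thesis using less by (simp add: valid_clustering_def)
    next
      case False
      then have "place k \<gamma> 0 x T = (L, insert x U)"
        using True by (simp add: T place_eq[OF J_def])
      then show ?thesis
        using greedy_cover_insert_unclustered[OF gc far] False len
        by (simp add: valid_clustering_def)
    qed
  qed
qed

definition remove_cluster :: "nat \<Rightarrow> 'a clustering \<Rightarrow> 'a clustering" where
  "remove_cluster i = (\<lambda>(L, U). (take i L @ drop (Suc i) L, U))"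

text \<open>
  Reinserting a point of the dissolved cluster amounts to inserting it from scratch when this
  cluster is absent and one cluster less is allowed.
\<close>

lemma remove_cluster_place:
  assumes i: "i < length L" and before: "\<forall>j<i. 2 * \<gamma> < dist x (fst (L ! j))"
  shows "remove_cluster i (place k \<gamma> (Suc i) x (L, U))
    = place (k - 1) \<gamma> 0 x (remove_cluster i (L, U))"
proof -
  define L' where "L' = take i L @ drop (Suc i) L"
  define J where "J = {j. Suc i \<le> j \<and> j < length L \<and> dist x (fst (L ! j)) \<le> 2 * \<gamma>}"
  define J' where "J' = {j. 0 \<le> j \<and> j < length L' \<and> dist x (fst (L' ! j)) \<le> 2 * \<gamma>}"
  have len: "length L' = length L - 1" using i by (simp add: L'_def)
  have nth: "L' ! j = (if j < i then L ! j else L ! Suc j)" if "j < length L'" for j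
    using that i by (auto simp: L'_def nth_append min_def)
  have J: "J = Suc ` J'"
  proof (rule set_eqI)
    fix j
    show "j \<in> J \<longleftrightarrow> j \<in> Suc ` J'"
    proof
      assume "j \<in> J"
      then have "j - 1 \<in> J'" "j = Suc (j - 1)" using len nth[of "j - 1"] by (auto simp: J_def J'_def)
      then show "j \<in> Suc ` J'" by blast
    next
      assume "j \<in> Suc ` J'"
      then obtain j' where j': "j = Suc j'" "j' < length L'" "dist x (fst (L' ! j')) \<le> 2 * \<gamma>"
        by (auto simp: J'_def)
      then have "\<not> j' < i" using before nth[of j'] by fastforce
      then show "j \<in> J" using j' nth[of j'] len by (auto simp: J_def)
    qed
  qed
  have rem: "remove_cluster i (M, W) = (take i M @ drop (Suc i) M, W)" for M W
    by (simp add: remove_cluster_def)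
  show ?thesis
  proof (cases "J' = {}")
    case True
    then have "J = {}" using J by simp
    have "place k \<gamma> (Suc i) x (L, U) = (if length L < k then (L @ [(x, {x})], U) else (L, insert x U))"
      using \<open>J = {}\<close> by (simp add: place_eq[OF J_def])
    moreover have "place (k - 1) \<gamma> 0 x (L', U)
        = (if length L' < k - 1 then (L' @ [(x, {x})], U) else (L', insert x U))"
      using True by (simp add: place_eq[OF J'_def])
    moreover have "length L' < k - 1 \<longleftrightarrow> length L < k" using len i by auto
    ultimately show ?thesis using i by (simp add: rem L'_def)
  next
    case False
    define j where "j = Min J'"
    have fin: "finite J'" by (simp add: J'_def)
    then have "j \<in> J'" using False by (simp add: j_def)
    then have "Suc j \<in> J" using J by blast
    then have j: "i \<le> j" "Suc j < length L" by (auto simp: J_def)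
    have "Min J = Suc j"
      using mono_Min_commute[of Suc J'] fin False by (simp add: J j_def mono_Suc)
    moreover have "J \<noteq> {}" using \<open>Suc j \<in> J\<close> by auto
    ultimately have "place k \<gamma> (Suc i) x (L, U)
        = (L[Suc j := (fst (L ! Suc j), insert x (snd (L ! Suc j)))], U)"
      by (simp add: place_eq[OF J_def])
    moreover have "place (k - 1) \<gamma> 0 x (L', U)
        = (L'[j := (fst (L' ! j), insert x (snd (L' ! j)))], U)"
      using False by (simp add: place_eq[OF J'_def] j_def)
    moreover have "L' ! j = L ! Suc j" using nth[of j] j len by simp
    ultimately show ?thesis
      using j i by (simp add: rem L'_def list_update_append drop_update_swap min_def Suc_diff_le)
  qed
qed

lemma place_preserves_prefix:
  assumes "i < length L" and "place k \<gamma> (Suc i) x (L, U) = (L', U')"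
  shows "i < length L'" and "\<forall>j\<le>i. L' ! j = L ! j"
proof -
  define J where "J = {j. Suc i \<le> j \<and> j < length L \<and> dist x (fst (L ! j)) \<le> 2 * \<gamma>}"
  have "finite J" by (simp add: J_def)
  then have "i < Min J" if "J \<noteq> {}"
    using that Min_in[of J] by (auto simp: J_def)
  then show "i < length L'" "\<forall>j\<le>i. L' ! j = L ! j"
    using assms by (auto simp: place_eq[OF J_def] nth_append split: if_splits)
qed

lemma valid_clustering_fold_place:
  assumes "valid_clustering (k - 1) \<gamma> S (remove_cluster i (L, U))" and "0 \<le> \<gamma>"
    and "i < length L" and "\<forall>x\<in>set xs. \<forall>j<i. 2 * \<gamma> < dist x (fst (L ! j))"
  shows "valid_clustering (k - 1) \<gamma> (S \<union> set xs)
    (remove_cluster i (fold (place k \<gamma> (Suc i)) xs (L, U)))"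
  using assms
proof (induction xs arbitrary: L U S)
  case Nil
  then show ?case by simp
next
  case (Cons x xs)
  obtain L' U' where T: "place k \<gamma> (Suc i) x (L, U) = (L', U')" by fastforce
  note pre = place_preserves_prefix[OF Cons.prems(3) T]
  have "remove_cluster i (L', U') = place (k - 1) \<gamma> 0 x (remove_cluster i (L, U))"
    using remove_cluster_place[OF Cons.prems(3), of \<gamma> x k U] Cons.prems(4) T by simp
  then have "valid_clustering (k - 1) \<gamma> (insert x S) (remove_cluster i (L', U'))"
    using valid_clustering_place[OF Cons.prems(1,2)] by simp
  then have "valid_clustering (k - 1) \<gamma> (insert x S \<union> set xs)
      (remove_cluster i (fold (place k \<gamma> (Suc i)) xs (L', U')))"
    by (rule Cons.IH) (use Cons.prems pre in auto)
  then show ?case using T by simp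
qed

lemma valid_clustering_rebuild:
  assumes "rebuild t_del k \<gamma> T T'" and "greedy_cover (2 * \<gamma>) S T" and "0 \<le> \<gamma>"
    and "length (fst T) \<le> k"
  shows "valid_clustering k \<gamma> S T'"
  using assms
proof (induction rule: rebuild.induct)
  case (stop U L)
  then show ?case by (auto simp: valid_clustering_def)
next
  case (step U L T T')
  show ?case
    by (rule step.IH)
      (use greedy_cover_open_center[OF step.hyps(3) step.prems(1,2)] step in auto)
qed

lemma valid_clustering_reclustering:
  assumes "reclustering t_del k \<gamma> T T'" and "valid_clustering k \<gamma> S T" and "0 \<le> \<gamma>"
  shows "valid_clustering k \<gamma> S T'"
  using assms
proof cases
  case balanced
  then show ?thesis using assms by simp
next
  case (recluster L U i)
  have "set (drop i L) = (!) L ` {i..<length L}"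
    by (metis add.left_neutral drop_map drop_upt map_nth set_map set_upt)
  then have "(\<Union>j\<in>{i..<length L}. snd (L ! j)) = (\<Union>cD\<in>set (drop i L). snd cD)"
    by simp
  moreover have "greedy_cover (2 * \<gamma>) S (take i L @ drop i L, U)"
    using assms(2) recluster by (simp add: valid_clustering_def)
  ultimately have "greedy_cover (2 * \<gamma>) S (take i L, U \<union> (\<Union>j\<in>{i..<length L}. snd (L ! j)))"
    using greedy_cover_dissolve_tail by metis
  then show ?thesis
    using valid_clustering_rebuild[OF recluster(4)] assms recluster
    by (auto simp: valid_clustering_def)
qed

lemma valid_clustering_insertion:
  assumes "insertion t_del k p \<gamma> T T'" and "valid_clustering k \<gamma> S T" and "0 \<le> \<gamma>"
  shows "valid_clustering k \<gamma> (insert p S) T'"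
  using assms valid_clustering_reclustering valid_clustering_place
  unfolding insertion_def by blast

lemma valid_clustering_delete_center:
  assumes valid: "valid_clustering k \<gamma> S (L, U)" and "0 \<le> \<gamma>" and i: "i < length L"
    and xs: "set xs = snd (L ! i) - {fst (L ! i)}"
    and T1: "fold (place k \<gamma> (Suc i)) xs (L, U) = (L1, U1)"
    and L2: "L2 = take i L1 @ drop (Suc i) L1"
    and T: "if U1 = {} then T = (L2, U1) else open_center t_del \<gamma> (L2, U1) T"
  shows "valid_clustering k \<gamma> (S - {fst (L ! i)}) T"
proof -
  let ?cD = "L ! i"
  have "greedy_cover (2 * \<gamma>) S (take i L @ ?cD # drop (Suc i) L, U)"
    using valid id_take_nth_drop[OF i] by (simp add: valid_clustering_def)
  then have "greedy_cover (2 * \<gamma>) (S - snd ?cD) (remove_cluster i (L, U))"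
    unfolding remove_cluster_def by (simp add: greedy_cover_delete_cluster)
  then have "valid_clustering (k - 1) \<gamma> (S - snd ?cD) (remove_cluster i (L, U))"
    using valid i by (auto simp: valid_clustering_def remove_cluster_def)
  moreover have "\<forall>x\<in>set xs. \<forall>j<i. 2 * \<gamma> < dist x (fst (L ! j))"
    using valid i xs by (auto simp: valid_clustering_def greedy_cover_def sorted_wrt_iff_nth_less)
  ultimately have "valid_clustering (k - 1) \<gamma> (S - snd ?cD \<union> set xs)
      (remove_cluster i (fold (place k \<gamma> (Suc i)) xs (L, U)))"
    using valid_clustering_fold_place assms(2) i by blast
  moreover have "S - snd ?cD \<union> set xs = S - {fst ?cD}"
    using valid nth_mem[OF i] xs by (auto simp: valid_clustering_def greedy_cover_def)
  ultimately have T2: "valid_clustering (k - 1) \<gamma> (S - {fst ?cD}) (L2, U1)"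
    by (simp add: T1 L2 remove_cluster_def)
  have "0 < k" using valid i by (auto simp: valid_clustering_def)
  show ?thesis
  proof (cases "U1 = {}")
    case True
    then show ?thesis using T T2 by (auto simp: valid_clustering_def)
  next
    case False
    then have "open_center t_del \<gamma> (L2, U1) T" using T by simp
    from greedy_cover_open_center[OF this _ assms(2)] show ?thesis
      using T2 False \<open>0 < k\<close> by (auto simp: valid_clustering_def)
  qed
qed

lemma valid_clustering_deletion:
  assumes "deletion t_del k p \<gamma> T T'" and "valid_clustering k \<gamma> S T" and "0 \<le> \<gamma>"
  shows "valid_clustering k \<gamma> (S - {p}) T'"
proof -
  have nc: "valid_clustering k \<gamma> (S - {p}) (map (\<lambda>(c, D). (c, D - {p})) L, U - {p})"
    if "p \<notin> fst ` set L" "T = (L, U)" for L U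
    using assms(2) that greedy_cover_delete_non_center[of "2 * \<gamma>" S L U p]
    by (auto simp: valid_clustering_def)
  from assms(1) show ?thesis
  proof cases
    case non_center
    then show ?thesis using nc by simp
  next
    case non_center_recluster
    show ?thesis
      by (rule valid_clustering_reclustering[OF _ nc])
        (use non_center_recluster assms(3) in auto)
  next
    case (center i L xs U L1 U1 L2 T2)
    have "valid_clustering k \<gamma> (S - {fst (L ! i)}) T2"
      by (rule valid_clustering_delete_center[of k \<gamma> S L U i xs L1 U1 L2 T2 t_del])
        (use center assms(2,3) in auto)
    then show ?thesis using center(3,9) valid_clustering_reclustering assms(3) by fast
  qed
qed

lemma flush_invariant:
  assumes "flush t_arr t_del k G t \<sigma> \<sigma>'" and "\<forall>\<gamma>\<in>G. 0 \<le> \<gamma>"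
    and "\<forall>\<gamma>\<in>G. valid_clustering k \<gamma> (fst \<sigma>) (snd \<sigma> \<gamma>)"
  shows "(\<forall>\<gamma>\<in>G. valid_clustering k \<gamma> (fst \<sigma>') (snd \<sigma>' \<gamma>)) \<and>
    fst \<sigma>' \<subseteq> fst \<sigma> \<and> {p \<in> fst \<sigma>. t < t_del p} \<subseteq> fst \<sigma>'"
  using assms
proof (induction rule: flush.induct)
  case (no_expired Q S)
  then show ?case by auto
next
  case (remove_min q Q S S1 \<sigma>')
  have "\<forall>\<gamma>\<in>G. valid_clustering k \<gamma> (Q - {q}) (S1 \<gamma>)"
  proof
    fix \<gamma> assume "\<gamma> \<in> G"
    then show "valid_clustering k \<gamma> (Q - {q}) (S1 \<gamma>)"
      using valid_clustering_deletion[of t_del k q \<gamma> "S \<gamma>" "S1 \<gamma>" Q] remove_min by simp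
  qed
  then have "(\<forall>\<gamma>\<in>G. valid_clustering k \<gamma> (fst \<sigma>') (snd \<sigma>' \<gamma>)) \<and>
      fst \<sigma>' \<subseteq> Q - {q} \<and> {p \<in> Q - {q}. t < t_del p} \<subseteq> fst \<sigma>'"
    using remove_min.IH remove_min.prems(1) by simp
  then show ?case using remove_min.hyps(2) by auto
qed

lemma run_invariant:
  assumes "run t_arr t_del k G calls \<sigma>" and "\<forall>\<gamma>\<in>G. 0 \<le> \<gamma>" and "\<forall>s\<in>set (map snd calls). s \<le> t"
  shows "(\<forall>\<gamma>\<in>G. valid_clustering k \<gamma> (fst \<sigma>) (snd \<sigma> \<gamma>)) \<and>
    fst \<sigma> \<subseteq> set (List.map_filter fst calls) \<and>
    {p \<in> set (List.map_filter fst calls). t < t_del p} \<subseteq> fst \<sigma>"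
  using assms
proof (induction rule: run.induct)
  case init
  then show ?case by (simp add: valid_clustering_def greedy_cover_def List.map_filter_def)
next
  case (call calls \<sigma> p s \<sigma>')
  have "s \<le> t" using call by simp
  have IH: "\<forall>\<gamma>\<in>G. valid_clustering k \<gamma> (fst \<sigma>) (snd \<sigma> \<gamma>)"
    "fst \<sigma> \<subseteq> set (List.map_filter fst calls)"
    "{p \<in> set (List.map_filter fst calls). t < t_del p} \<subseteq> fst \<sigma>"
    using call by auto
  from call.hyps(2) show ?case
  proof cases
    case null
    note fl = flush_invariant[OF null(2) call.prems(1) IH(1)]
    moreover have "List.map_filter fst (calls @ [(p, s)]) = List.map_filter fst calls"
      using null(1) by (simp add: List.map_filter_def)
    ultimately show ?thesis using IH \<open>s \<le> t\<close> by auto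
  next
    case (arrival Q S p' S')
    note fl = flush_invariant[OF arrival(3) call.prems(1) IH(1)]
    have "\<forall>\<gamma>\<in>G. valid_clustering k \<gamma> (insert p' Q) (S' \<gamma>)"
    proof
      fix \<gamma> assume "\<gamma> \<in> G"
      then show "valid_clustering k \<gamma> (insert p' Q) (S' \<gamma>)"
        using valid_clustering_insertion[of t_del k p' \<gamma> "S \<gamma>" "S' \<gamma>" Q] fl arrival(4)
          call.prems(1) by simp
    qed
    moreover have "set (List.map_filter fst (calls @ [(p, s)]))
        = insert p' (set (List.map_filter fst calls))"
      using arrival(1) by (simp add: List.map_filter_def)
    ultimately show ?thesis using fl IH arrival(2) \<open>s \<le> t\<close> by auto
  qed
qed


section \<open>Approximation\<close>

lemma valid_clustering_centers:
  assumes "valid_clustering k \<gamma> S (L, U)"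
  shows "fst ` set L \<subseteq> S" and "card (fst ` set L) \<le> k"
proof -
  show "fst ` set L \<subseteq> S"
    using assms by (auto simp: valid_clustering_def greedy_cover_def)
  have "card (fst ` set L) \<le> length L"
    using card_image_le[of "set L" fst] card_length[of L] by simp
  then show "card (fst ` set L) \<le> k" using assms by (simp add: valid_clustering_def)
qed

lemma cost_le:
  assumes "\<And>p. p \<in> S \<Longrightarrow> \<exists>q\<in>C. dist p q \<le> r"
  shows "cost C S \<le> ennreal r"
  unfolding cost_def dist_to_def
  by (rule SUP_least) (use assms in \<open>meson INF_lower2 ennreal_leI\<close>)

lemma valid_clustering_close_center:
  assumes "valid_clustering k \<gamma> S (L, {})" and "p \<in> S"
  shows "\<exists>q\<in>fst ` set L. dist p q \<le> 2 * \<gamma>"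
  using assms by (auto simp: valid_clustering_def greedy_cover_def)

lemma cost_less_imp_close:
  assumes "cost C S < ennreal r" and "p \<in> S"
  shows "\<exists>q\<in>C. dist p q < r"
proof -
  have "dist_to p C < ennreal r"
    using assms unfolding cost_def by (meson SUP_upper le_less_trans)
  then show ?thesis by (auto simp: dist_to_def INF_less_iff ennreal_less_iff)
qed

lemma opt_cost_ge_separated:
  assumes "P \<subseteq> S" and "k < card P" and sep: "\<And>x y. x \<in> P \<Longrightarrow> y \<in> P \<Longrightarrow> x \<noteq> y \<Longrightarrow> 2 * r < dist x y"
  shows "ennreal r \<le> opt_cost k S"
  unfolding opt_cost_def
proof (rule INF_greatest, rule ccontr)
  fix C assume C: "C \<in> {C. C \<subseteq> S \<and> finite C \<and> card C \<le> k}"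
    and "\<not> ennreal r \<le> cost C S"
  then have "\<forall>p\<in>P. \<exists>q\<in>C. dist p q < r"
    using cost_less_imp_close assms(1) by (metis not_le subsetD)
  then obtain f where f: "\<forall>p\<in>P. f p \<in> C \<and> dist p (f p) < r" by metis
  then have "\<not> inj_on f P"
    using C assms(2) card_inj_on_le[of f P C] by fastforce
  then obtain x y where xy: "x \<in> P" "y \<in> P" "x \<noteq> y" "f x = f y" by (auto simp: inj_on_def)
  have "dist x y \<le> dist x (f x) + dist y (f x)" by (rule dist_triangle2)
  also have "\<dots> < r + r" using f xy by (intro add_strict_mono) auto
  finally show False using sep[OF xy(1-3)] by simp
qed

text \<open>Here it matters that centers are chosen from \<open>S\<close>; otherwise only \<open>r / 2\<close> is a bound.\<close>

lemma opt_cost_ge_min_dist: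
  assumes "k < card S" and "\<And>x y. x \<in> S \<Longrightarrow> y \<in> S \<Longrightarrow> x \<noteq> y \<Longrightarrow> r \<le> dist x y"
  shows "ennreal r \<le> opt_cost k S"
  unfolding opt_cost_def
proof (rule INF_greatest, rule ccontr)
  fix C assume C: "C \<in> {C. C \<subseteq> S \<and> finite C \<and> card C \<le> k}"
    and less: "\<not> ennreal r \<le> cost C S"
  then have "\<not> S \<subseteq> C" using assms(1) by auto
  then obtain p where p: "p \<in> S" "p \<notin> C" by auto
  then obtain q where "q \<in> C" "dist p q < r"
    using cost_less_imp_close less by (metis not_le)
  then show False using assms(2)[of p q] p C by fastforce
qed

lemma opt_cost_ge_unclustered:
  assumes "valid_clustering k \<gamma> S (L, U)" and "U \<noteq> {}" and "0 \<le> \<gamma>"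
  shows "ennreal \<gamma> \<le> opt_cost k S"
proof -
  from assms(2) obtain u where u: "u \<in> U" by auto
  have gc: "greedy_cover (2 * \<gamma>) S (L, U)" and len: "length L = k"
    using assms by (auto simp: valid_clustering_def)
  let ?c = "\<lambda>i. fst (L ! i)"
  have less: "2 * \<gamma> < dist (?c j) (?c i)" if "i < j" "j < length L" for i j
    using gc that by (auto simp: greedy_cover_def sorted_wrt_iff_nth_less)
  then have sep: "2 * \<gamma> < dist (?c i) (?c j)" if "i \<noteq> j" "i < length L" "j < length L" for i j
    using that by (metis dist_commute linorder_neqE_nat)
  have u_far: "2 * \<gamma> < dist u c" if "c \<in> fst ` set L" for c
    using gc u that by (auto simp: greedy_cover_def)
  have centers: "fst ` set L = ?c ` {..<length L}"
    by (force simp: in_set_conv_nth image_iff)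
  have "inj_on ?c {..<length L}"
  proof (rule inj_onI, rule ccontr)
    fix i j assume "i \<in> {..<length L}" "j \<in> {..<length L}" "?c i = ?c j" "i \<noteq> j"
    then show False using sep[of i j] assms(3) by simp
  qed
  then have "card (fst ` set L) = k" unfolding centers using len by (simp add: card_image)
  moreover have "u \<notin> fst ` set L" using u_far[of u] assms(3) by auto
  ultimately have "k < card (insert u (fst ` set L))" by simp
  moreover have "insert u (fst ` set L) \<subseteq> S"
    using valid_clustering_centers(1)[OF assms(1)] u gc by (auto simp: greedy_cover_def)
  moreover have "2 * \<gamma> < dist x y"
    if "x \<in> insert u (fst ` set L)" "y \<in> insert u (fst ` set L)" "x \<noteq> y" for x y
  proof -
    have "2 * \<gamma> < dist x y" if "x \<in> fst ` set L" "y \<in> fst ` set L"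
    proof -
      from that obtain i j where "x = ?c i" "y = ?c j" "i < length L" "j < length L"
        unfolding centers by auto
      then show ?thesis using sep[of i j] \<open>x \<noteq> y\<close> by auto
    qed
    moreover have "2 * \<gamma> < dist x y" if "x = u" "y \<in> fst ` set L"
      using u_far[OF that(2)] that(1) by simp
    moreover have "2 * \<gamma> < dist x y" if "y = u" "x \<in> fst ` set L"
      using u_far[OF that(2)] that(1) by (simp add: dist_commute)
    ultimately show ?thesis using that by blast
  qed
  ultimately show ?thesis using opt_cost_ge_separated by blast
qed

lemma finite_pair_dists: "finite X \<Longrightarrow> finite (pair_dists X)"
  by (rule finite_subset[of _ "(\<lambda>(x, y). dist x y) ` (X \<times> X)"]) (auto simp: pair_dists_def)

lemma pair_dists_bounds:
  assumes "finite X" and "x \<in> X" and "y \<in> X" and "x \<noteq> y"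
  shows "d_min X \<le> dist x y" and "dist x y \<le> d_max X"
  using assms finite_pair_dists[OF assms(1)]
  by (auto simp: d_min_def d_max_def pair_dists_def intro!: Min_le Max_ge)

theorem theorem3p3:
  fixes X :: "'a::metric_space set" and t_arr t_del :: "'a \<Rightarrow> nat"
    and k t :: nat and \<epsilon> :: real and \<sigma> :: "'a state"
  assumes "finite X" and "2 \<le> card X"
    and "\<forall>p\<in>X. t_arr p < t_del p" and "inj_on t_arr X"
    and "1 \<le> k" and "0 < \<epsilon>"
    and "query_state X t_arr t_del k \<epsilon> t \<sigma>"
  defines "C \<equiv> set (query (guesses X \<epsilon>) \<sigma>)" and "A \<equiv> active X t_arr t_del t"
  shows "C \<subseteq> A \<and> card C \<le> k \<and>
    (k < card A \<or> (\<forall>x\<in>A. \<forall>y\<in>A. x \<noteq> y \<longrightarrow> 2 * Min (guesses X \<epsilon>) < dist x y)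
      \<longrightarrow> cost C A \<le> ennreal (2 + \<epsilon>) * opt_cost k A)"
proof -
  define b where "b = 1 + \<epsilon> / 2"
  define lo where "lo = \<lfloor>log b (d_min X)\<rfloor>"
  define hi where "hi = \<lceil>log b (d_max X)\<rceil>"
  define G where "G = guesses X \<epsilon>"
  have b: "1 < b" using assms(6) by (simp add: b_def)
  have G: "G = (\<lambda>i. b powi i) ` {lo..hi}"
    by (auto simp: G_def guesses_def Let_def b_def lo_def hi_def)
  then have finG: "finite G" by simp
  have Gpos: "0 < \<gamma>" if "\<gamma> \<in> G" for \<gamma> using that b by (auto simp: G)
  obtain x0 y0 where xy0: "x0 \<in> X" "y0 \<in> X" "x0 \<noteq> y0"
    using assms(2) card_le_Suc0_iff_eq[OF assms(1)] by auto
  then have "pair_dists X \<noteq> {}" by (auto simp: pair_dists_def)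
  then have "d_min X \<in> pair_dists X"
    using finite_pair_dists[OF assms(1)] by (simp add: d_min_def)
  then have dmin: "0 < d_min X" by (auto simp: pair_dists_def)
  have dmax: "d_min X \<le> d_max X" using pair_dists_bounds[OF assms(1) xy0] by simp
  have "log b (d_min X) \<le> log b (d_max X)" using dmin dmax b by simp
  then have lohi: "lo \<le> hi" unfolding lo_def hi_def by linarith
  have lo_le: "b powi lo \<le> d_min X"
    using b dmin by (simp add: powr_real_of_int'[symmetric] lo_def flip: le_log_iff)
  have hi_ge: "d_max X \<le> b powi hi"
    using b dmin dmax by (simp add: powr_real_of_int'[symmetric] hi_def flip: log_le_iff)
  obtain Q S where \<sigma>: "\<sigma> = (Q, S)" by (cases \<sigma>)
  from assms(7) obtain calls where calls: "history X t_arr t calls"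
    "run t_arr t_del k G calls \<sigma>" and live: "\<forall>q\<in>Q. t < t_del q"
    unfolding query_state_def G_def \<sigma> by auto
  have inv: "\<forall>\<gamma>\<in>G. valid_clustering k \<gamma> Q (S \<gamma>)"
    and "Q \<subseteq> set (List.map_filter fst calls)"
    and "{p \<in> set (List.map_filter fst calls). t < t_del p} \<subseteq> Q"
    using run_invariant[OF calls(2), of t] calls(1) Gpos
    by (auto simp: \<sigma> history_def less_imp_le)
  then have QA: "Q = A" using live calls(1) by (auto simp: A_def active_def history_def)
  have AX: "A \<subseteq> X" by (auto simp: A_def active_def)
  have valid: "valid_clustering k \<gamma> A (fst (S \<gamma>), snd (S \<gamma>))" if "\<gamma> \<in> G" for \<gamma>
    using inv that QA by simp
  define F where "F = {\<gamma> \<in> G. snd (S \<gamma>) = {}}"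
  have "b powi hi \<in> F"
  proof -
    have hiG: "b powi hi \<in> G" using lohi by (simp add: G)
    have "snd (S (b powi hi)) = {}"
    proof (rule ccontr)
      assume ne: "snd (S (b powi hi)) \<noteq> {}"
      then obtain u where u: "u \<in> snd (S (b powi hi))" by auto
      have "length (fst (S (b powi hi))) = k"
        using valid[OF hiG] ne by (simp add: valid_clustering_def)
      then have "fst (S (b powi hi)) \<noteq> []" using assms(5) by auto
      then obtain cD where cD: "cD \<in> set (fst (S (b powi hi)))" by (meson list.set_sel(1))
      have far: "2 * b powi hi < dist u (fst cD)" and "u \<in> A"
        using valid[OF hiG] u cD by (auto simp: valid_clustering_def greedy_cover_def)
      moreover have "fst cD \<in> A" using valid_clustering_centers(1)[OF valid[OF hiG]] cD by auto
      moreover have "u \<noteq> fst cD" using far Gpos[OF hiG] by auto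
      ultimately have "dist u (fst cD) \<le> d_max X"
        using pair_dists_bounds(2)[OF assms(1)] AX by blast
      then show False using far hi_ge Gpos[OF hiG] by linarith
    qed
    then show ?thesis using hiG by (simp add: F_def)
  qed
  moreover have finF: "finite F" using finG by (simp add: F_def)
  moreover define g where "g = Min F"
  ultimately have "g \<in> F" using Min_in[of F] by blast
  then have gG: "g \<in> G" and Ug: "snd (S g) = {}" by (auto simp: F_def)
  have C: "C = fst ` set (fst (S g))"
    by (simp add: C_def query_def \<sigma> g_def F_def G_def)
  note vg = valid[OF gG, unfolded Ug]
  have close: "\<exists>q\<in>C. dist p q \<le> 2 * g" if "p \<in> A" for p
    using valid_clustering_close_center[OF vg that] C by simp
  have sub: "C \<subseteq> A" and card: "card C \<le> k"
    using valid_clustering_centers[OF vg] C by auto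
  have cost_le_g: "cost C A \<le> ennreal (2 * g)" by (rule cost_le) (rule close)
  from gG obtain i where i: "g = b powi i" "lo \<le> i" "i \<le> hi" by (auto simp: G)
  have "cost C A \<le> ennreal (2 + \<epsilon>) * opt_cost k A"
    if more: "k < card A \<or> (\<forall>x\<in>A. \<forall>y\<in>A. x \<noteq> y \<longrightarrow> 2 * Min G < dist x y)"
  proof (cases "i = lo")
    case False
    define g' where "g' = b powi (i - 1)"
    have g'G: "g' \<in> G" using False i by (auto simp: G g'_def)
    have g: "g = b * g'" using b by (simp add: i g'_def power_int_diff)
    then have "g' < g" using b Gpos[OF g'G] by simp
    then have "g' \<notin> F" using Min_le[OF finF, of g'] by (auto simp: g_def)
    then have "snd (S g') \<noteq> {}" using g'G by (simp add: F_def)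
    then have opt: "ennreal g' \<le> opt_cost k A"
      using opt_cost_ge_unclustered[OF valid[OF g'G]] Gpos[OF g'G] by simp
    have "2 * g = (2 + \<epsilon>) * g'" by (simp add: g b_def algebra_simps)
    then have "cost C A \<le> ennreal (2 + \<epsilon>) * ennreal g'"
      using cost_le_g assms(6) Gpos[OF g'G] by (simp add: ennreal_mult)
    also have "\<dots> \<le> ennreal (2 + \<epsilon>) * opt_cost k A" using opt by (simp add: mult_left_mono)
    finally show ?thesis .
  next
    case True
    from more show ?thesis
    proof
      assume "k < card A"
      then have "ennreal (d_min X) \<le> opt_cost k A"
        using opt_cost_ge_min_dist pair_dists_bounds(1)[OF assms(1)] AX by blast
      moreover have "ennreal g \<le> ennreal (d_min X)" using lo_le True i by (simp add: ennreal_leI)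
      ultimately have opt: "ennreal g \<le> opt_cost k A" by (rule order_trans[rotated])
      have "2 * g \<le> (2 + \<epsilon>) * g" using assms(6) Gpos[OF gG] by simp
      then have "ennreal (2 * g) \<le> ennreal ((2 + \<epsilon>) * g)" by (rule ennreal_leI)
      also have "\<dots> = ennreal (2 + \<epsilon>) * ennreal g"
        using assms(6) Gpos[OF gG] by (simp add: ennreal_mult)
      also have "\<dots> \<le> ennreal (2 + \<epsilon>) * opt_cost k A" using opt by (simp add: mult_left_mono)
      finally show ?thesis using cost_le_g by (rule order_trans[rotated])
    next
      assume sep: "\<forall>x\<in>A. \<forall>y\<in>A. x \<noteq> y \<longrightarrow> 2 * Min G < dist x y"
      have "g \<le> \<gamma>" if "\<gamma> \<in> G" for \<gamma>
        using that b True i by (auto simp: G intro!: power_int_increasing)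
      then have "Min G = g" using finG gG by (intro Min_eqI) auto
      then have "A \<subseteq> C" using close sep sub by (metis not_le subsetD subsetI)
      then have "cost C A \<le> ennreal 0"
        by (intro cost_le) (use dist_self in \<open>force\<close>)
      then show ?thesis by simp
    qed
  qed
  then show ?thesis using sub card unfolding G_def by blast
qed

end
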